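(* Let $(X^{(n)})_{n\ge1}$ be a sequence of transitive, reversible and irreducible continuous time Markov chains, with state spaces $S^{(n)}$, spectral gaps $(\lambda_1^{(n)})_{n\ge1}$ and bottleneck ratios $(\Phi_*^{(n)})_{n\ge1}$. If $\lambda_1^{(n)}\asymp\Phi_*^{(n)}$, then there exists at least one nondegenerate sequence of Boolean functions $(f_n)_{n\ge1}$, $f_n\colon S^{(n)}\to\{0,1\}$, which is noise stable with respect to $(X^{(n)})_{n\ge1}$.
   Context: Each $X^{(n)}=(X^{(n)}_t)_{t\ge0}$ has a finite state space $S^{(n)}$ with $|S^{(n)}|\ge2$, generator $Q_n$ and stationary distribution $\pi_n$; $X_0^{(n)}$ is always distributed according to $\pi_n$. The spectral gap $\lambda_1^{(n)}>0$ is the smallest nonzero eigenvalue of $-Q_n$; the relaxation time is $t_{rel}^{(n)}=1/\lambda_1^{(n)}$. For a chain with state space $S$, generator $Q=(q_{ij})$ and stationary distribution $\pi$, and nonempty $A\subseteq S$, put $\Phi(A)=\frac{1}{\pi(A)}\sum_{i\in A,\,j\in A^c}\pi(i)q_{ij}$; the bottleneck ratio is $\Phi_*=\inf\{\Phi(A)\colon\emptyset\ne A\subset S,\ \pi(A)\le1/2\}$. $\Phi_*^{(n)}$ is the bottleneck ratio of $X^{(n)}$. $a_n\asymp b_n$ means that there are constants $0<c\le C<\infty$ with $c\,b_n\le a_n\le C\,b_n$ for all $n$. A Markov chain with state space $S$ and generator $Q=(q_{ij})_{i,j\in S}$ is transitive if for any $i,j\in S$ there is a bijection $\varphi\colon S\to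 S$ such that $\varphi(i)=j$ and $q_{\varphi(a)\varphi(b)}=q_{ab}$ for all $a,b\in S$. A sequence $(f_n)_{n\ge1}$ of Boolean functions $f_n\colon S^{(n)}\to\{0,1\}$ is nondegenerate if $\liminf_{n\to\infty}\operatorname{Var}(f_n)>0$, where $\operatorname{Var}(f_n)$ is the variance of $f_n(w)$ for $w\sim\pi_n$. It is noise stable with respect to $(X^{(n)})_{n\ge1}$ if $\lim_{\alpha\to0^+}\sup_n P\bigl(f_n(X_0^{(n)})\ne f_n(X^{(n)}_{\alpha t_{rel}^{(n)}})\bigr)=0$. *)

theory Defs
  imports "HOL-Probability.Probability"
begin

text \<open>
  A state space is a finite set \<open>S\<close>; matrices and vectors indexed by \<open>S\<close> are functions on the
  ambient type, of which only the values on \<open>S\<close> are ever used.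
\<close>

definition generator :: "'a set \<Rightarrow> ('a \<Rightarrow> 'a \<Rightarrow> real) \<Rightarrow> bool" where
  "generator S Q \<longleftrightarrow>
     (\<forall>i\<in>S. \<forall>j\<in>S. i \<noteq> j \<longrightarrow> Q i j \<ge> 0) \<and> (\<forall>i\<in>S. (\<Sum>j\<in>S. Q i j) = 0)"

definition distribution_on :: "'a set \<Rightarrow> ('a \<Rightarrow> real) \<Rightarrow> bool" where
  "distribution_on S p \<longleftrightarrow> (\<forall>i\<in>S. p i \<ge> 0) \<and> (\<Sum>i\<in>S. p i) = 1"

definition stationary :: "'a set \<Rightarrow> ('a \<Rightarrow> 'a \<Rightarrow> real) \<Rightarrow> ('a \<Rightarrow> real) \<Rightarrow> bool" where
  "stationary S Q p \<longleftrightarrow> distribution_on S p \<and> (\<forall>j\<in>S. (\<Sum>i\<in>S. p i * Q i j) = 0)"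

definition reversible :: "'a set \<Rightarrow> ('a \<Rightarrow> 'a \<Rightarrow> real) \<Rightarrow> ('a \<Rightarrow> real) \<Rightarrow> bool" where
  "reversible S Q p \<longleftrightarrow> (\<forall>i\<in>S. \<forall>j\<in>S. p i * Q i j = p j * Q j i)"

definition irreducible_chain :: "'a set \<Rightarrow> ('a \<Rightarrow> 'a \<Rightarrow> real) \<Rightarrow> bool" where
  "irreducible_chain S Q \<longleftrightarrow>
     (\<forall>i\<in>S. \<forall>j\<in>S. (i, j) \<in> {(a, b). a \<in> S \<and> b \<in> S \<and> a \<noteq> b \<and> Q a b > 0}\<^sup>*)"

definition transitive_chain :: "'a set \<Rightarrow> ('a \<Rightarrow> 'a \<Rightarrow> real) \<Rightarrow> bool" where
  "transitive_chain S Q \<longleftrightarrow>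
     (\<forall>i\<in>S. \<forall>j\<in>S. \<exists>\<phi>. bij_betw \<phi> S S \<and> \<phi> i = j \<and> (\<forall>a\<in>S. \<forall>b\<in>S. Q (\<phi> a) (\<phi> b) = Q a b))"

fun matrix_power :: "'a set \<Rightarrow> ('a \<Rightarrow> 'a \<Rightarrow> real) \<Rightarrow> nat \<Rightarrow> 'a \<Rightarrow> 'a \<Rightarrow> real" where
  "matrix_power S Q 0 i j = (if i = j then 1 else 0)"
| "matrix_power S Q (Suc k) i j = (\<Sum>l\<in>S. Q i l * matrix_power S Q k l j)"

text \<open>The transition matrix \<open>P\<^sub>t = exp (t Q)\<close>, entrywise as the exponential power series.\<close>

definition transition :: "'a set \<Rightarrow> ('a \<Rightarrow> 'a \<Rightarrow> real) \<Rightarrow> real \<Rightarrow> 'a \<Rightarrow> 'a \<Rightarrow> real" where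
  "transition S Q t i j = (\<Sum>k. t ^ k / fact k * matrix_power S Q k i j)"

text \<open>
  A continuous time Markov chain with generator \<open>Q\<close> and initial law \<open>p\<close> on the probability space
  \<open>M\<close>, specified by its finite-dimensional distributions. No regularity of paths is required.
\<close>

definition markov_chain ::
  "'w measure \<Rightarrow> 'a set \<Rightarrow> ('a \<Rightarrow> 'a \<Rightarrow> real) \<Rightarrow> ('a \<Rightarrow> real) \<Rightarrow> (real \<Rightarrow> 'w \<Rightarrow> 'a) \<Rightarrow> bool" where
  "markov_chain M S Q p X \<longleftrightarrow>
     prob_space M \<and> generator S Q \<and> distribution_on S p \<and>
     (\<forall>t\<ge>0. X t \<in> measurable M (count_space S)) \<and>
     (\<forall>(m::nat) (t :: nat \<Rightarrow> real) (x :: nat \<Rightarrow> 'a).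
        t 0 = 0 \<and> (\<forall>k<m. t k \<le> t (Suc k)) \<and> (\<forall>k\<le>m. x k \<in> S) \<longrightarrow>
        measure M {w \<in> space M. \<forall>k\<le>m. X (t k) w = x k} =
          p (x 0) * (\<Prod>k<m. transition S Q (t (Suc k) - t k) (x k) (x (Suc k))))"

text \<open>Real \<open>\<mu>\<close> suffices: a chain that is reversible with respect to a strictly positive
  stationary distribution has only real eigenvalues.\<close>

definition neg_generator_eigenvalue :: "'a set \<Rightarrow> ('a \<Rightarrow> 'a \<Rightarrow> real) \<Rightarrow> real \<Rightarrow> bool" where
  "neg_generator_eigenvalue S Q \<mu> \<longleftrightarrow>
     (\<exists>g :: 'a \<Rightarrow> real. (\<exists>i\<in>S. g i \<noteq> 0) \<and> (\<forall>i\<in>S. (\<Sum>j\<in>S. - Q i j * g j) = \<mu> * g i))"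

definition spectral_gap :: "'a set \<Rightarrow> ('a \<Rightarrow> 'a \<Rightarrow> real) \<Rightarrow> real" where
  "spectral_gap S Q = (LEAST \<mu>. neg_generator_eigenvalue S Q \<mu> \<and> \<mu> \<noteq> 0)"

definition relaxation_time :: "'a set \<Rightarrow> ('a \<Rightarrow> 'a \<Rightarrow> real) \<Rightarrow> real" where
  "relaxation_time S Q = 1 / spectral_gap S Q"

definition bottleneck_ratio_of ::
  "'a set \<Rightarrow> ('a \<Rightarrow> 'a \<Rightarrow> real) \<Rightarrow> ('a \<Rightarrow> real) \<Rightarrow> 'a set \<Rightarrow> real" where
  "bottleneck_ratio_of S Q p A = 1 / (\<Sum>i\<in>A. p i) * (\<Sum>i\<in>A. \<Sum>j\<in>S - A. p i * Q i j)"

definition bottleneck_ratio :: "'a set \<Rightarrow> ('a \<Rightarrow> 'a \<Rightarrow> real) \<Rightarrow> ('a \<Rightarrow> real) \<Rightarrow> real" where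
  "bottleneck_ratio S Q p =
     Inf {bottleneck_ratio_of S Q p A | A. A \<noteq> {} \<and> A \<subset> S \<and> (\<Sum>i\<in>A. p i) \<le> 1 / 2}"

text \<open>Sequences are indexed by \<open>n \<ge> 1\<close>; the value at \<open>0\<close> is ignored throughout. The library's
  \<open>\<Theta>\<close> is not used here because it is insensitive to finitely many \<open>n\<close>.\<close>

definition comparable :: "(nat \<Rightarrow> real) \<Rightarrow> (nat \<Rightarrow> real) \<Rightarrow> bool" where
  "comparable a b \<longleftrightarrow>
     (\<exists>c C. 0 < c \<and> c \<le> C \<and> (\<forall>n\<ge>1. c * b n \<le> a n \<and> a n \<le> C * b n))"

definition mean_on :: "'a set \<Rightarrow> ('a \<Rightarrow> real) \<Rightarrow> ('a \<Rightarrow> real) \<Rightarrow> real" where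
  "mean_on S p g = (\<Sum>i\<in>S. p i * g i)"

definition variance_on :: "'a set \<Rightarrow> ('a \<Rightarrow> real) \<Rightarrow> ('a \<Rightarrow> real) \<Rightarrow> real" where
  "variance_on S p g = mean_on S p (\<lambda>i. (g i - mean_on S p g)\<^sup>2)"

definition nondegenerate ::
  "(nat \<Rightarrow> 'a set) \<Rightarrow> (nat \<Rightarrow> 'a \<Rightarrow> real) \<Rightarrow> (nat \<Rightarrow> 'a \<Rightarrow> real) \<Rightarrow> bool" where
  "nondegenerate S p f \<longleftrightarrow> liminf (\<lambda>n. ereal (variance_on (S n) (p n) (f n))) > 0"

definition noise_stable ::
  "(nat \<Rightarrow> 'w measure) \<Rightarrow> (nat \<Rightarrow> 'a set) \<Rightarrow> (nat \<Rightarrow> 'a \<Rightarrow> 'a \<Rightarrow> real) \<Rightarrow>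
   (nat \<Rightarrow> real \<Rightarrow> 'w \<Rightarrow> 'a) \<Rightarrow> (nat \<Rightarrow> 'a \<Rightarrow> real) \<Rightarrow> bool" where
  "noise_stable M S Q X f \<longleftrightarrow>
     ((\<lambda>\<alpha>. SUP n\<in>{1..}. measure (M n)
         {w \<in> space (M n). f n (X n 0 w) \<noteq> f n (X n (\<alpha> * relaxation_time (S n) (Q n)) w)})
       \<longlongrightarrow> 0) (at_right 0)"

end

theory Submission
  imports Defs
begin

text \<open>
  The functions \<open>f\<^sub>n\<close> are indicators of sets \<open>B\<^sub>n\<close> that attain the bottleneck ratio and have
  stationary mass between \<open>1 / 4\<close> and \<open>1 / 2\<close>. The mass bounds give the variance a positive lower
  bound, so two things have to be explained: why such sets exist, and why they are noise stable.

  Existence. The boundary flow \<open>A \<mapsto> \<Sum>i\<in>A. \<Sum>j\<in>S - A. p i * Q i j\<close> is submodular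
  (\<open>flow_submodular\<close>), while \<open>p\<close> is additive. Hence, if two sets attain the bottleneck ratio and
  their union still has mass at most \<open>1 / 2\<close>, the union attains it as well
  (\<open>bottleneck_attained_union\<close>). Symmetries of \<open>Q\<close> preserve \<open>p\<close>, hence also the flow, so every
  translate \<open>\<phi> ` B\<close> of an optimal set \<open>B\<close> is optimal. If an inclusion-maximal optimal set had mass
  below \<open>1 / 4\<close>, its union with any translate would have mass below \<open>1 / 2\<close>, so by maximality it
  would contain all of its translates; by transitivity it would be the whole space
  (\<open>large_bottleneck_set\<close>).

  Stability. For a stationary process the probability \<open>D t\<close> that \<open>f (X 0) \<noteq> f (X t)\<close> is subadditive
  in \<open>t\<close>, and it vanishes at \<open>0\<close>, so it lies below its tangent at \<open>0\<close>. For the indicator of \<open>B\<close> the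
  slope of that tangent is twice the boundary flow of \<open>B\<close> (\<open>indicator_change_prob\<close>). For an optimal
  \<open>B\<close> of mass at most \<open>1 / 2\<close> this yields \<open>D t \<le> t * \<Phi>\<close>, where \<open>\<Phi>\<close> is the bottleneck ratio, and at
  \<open>t = \<alpha> / \<lambda>\<close> a gap \<open>\<lambda> \<ge> c * \<Phi>\<close> turns this into \<open>\<alpha> / c\<close>, uniformly in \<open>n\<close>. Since \<open>\<Phi> > 0\<close> by
  irreducibility, the same comparison shows that \<open>\<lambda> > 0\<close>.
\<close>

section \<open>Reversible irreducible chains\<close>

locale reversible_chain =
  fixes S :: "'a set" and Q :: "'a \<Rightarrow> 'a \<Rightarrow> real" and p :: "'a \<Rightarrow> real"
  assumes finite_states: "finite S"
    and card_states: "card S \<ge> 2"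
    and generator: "generator S Q"
    and stationary: "stationary S Q p"
    and reversible: "reversible S Q p"
    and irreducible: "irreducible_chain S Q"
begin

lemma rate_nonneg: "i \<in> S \<Longrightarrow> j \<in> S \<Longrightarrow> i \<noteq> j \<Longrightarrow> Q i j \<ge> 0"
  using generator by (auto simp: generator_def)

lemma detailed_balance: "i \<in> S \<Longrightarrow> j \<in> S \<Longrightarrow> p i * Q i j = p j * Q j i"
  using reversible by (auto simp: reversible_def)

lemma law_nonneg: "i \<in> S \<Longrightarrow> p i \<ge> 0"
  using stationary by (auto simp: stationary_def distribution_on_def)

lemma law_total: "sum p S = 1"
  using stationary by (auto simp: stationary_def distribution_on_def)

text \<open>
  The form in which irreducibility is applied: to show that a property holds on all of \<open>S\<close>, it is
  enough that it holds somewhere and is passed on along transitions of positive rate.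
\<close>

lemma exit_edge:
  assumes "A \<noteq> {}" "A \<subset> S"
  obtains a b where "a \<in> A" "b \<in> S - A" "Q a b > 0"
proof -
  obtain a b where ab: "a \<in> A" "b \<in> S - A" using assms by blast
  let ?E = "{(a, b). a \<in> S \<and> b \<in> S \<and> a \<noteq> b \<and> Q a b > 0}"
  have "(a, b) \<in> ?E\<^sup>*"
    using irreducible ab assms unfolding irreducible_chain_def by blast
  moreover have "x \<in> A" if "(a, x) \<in> ?E\<^sup>*" "\<not> (\<exists>a\<in>A. \<exists>b\<in>S - A. Q a b > 0)" for x
    using that(1) by induction (use ab that(2) in auto)
  ultimately have "\<exists>a\<in>A. \<exists>b\<in>S - A. Q a b > 0" using ab by blast
  then show ?thesis using that by blast
qed

lemma law_pos:
  assumes "i \<in> S"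
  shows "p i > 0"
proof (rule ccontr)
  assume i: "\<not> p i > 0"
  let ?Z = "{i \<in> S. p i > 0}"
  have "?Z \<noteq> {}"
  proof
    assume "?Z = {}"
    then have "sum p S \<le> 0" by (intro sum_nonpos) (auto simp: not_less)
    then show False using law_total by simp
  qed
  moreover have "?Z \<subset> S" using i assms by blast
  ultimately obtain a b where ab: "a \<in> ?Z" "b \<in> S - ?Z" "Q a b > 0"
    by (rule exit_edge)
  have "p b = 0" using ab law_nonneg[of b] by auto
  then have "p a * Q a b = 0" using detailed_balance[of a b] ab by simp
  then show False using ab by simp
qed

text \<open>
  Both \<open>p\<close> and \<open>p \<circ> \<phi>\<close> satisfy detailed balance for \<open>Q\<close>, so the ratio of the two is constant along
  every transition of positive rate, hence constant on \<open>S\<close>; as both have total mass \<open>1\<close>, it is \<open>1\<close>.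
\<close>

lemma law_automorphism_invariant:
  assumes bij: "bij_betw \<phi> S S" and Q: "\<forall>a\<in>S. \<forall>b\<in>S. Q (\<phi> a) (\<phi> b) = Q a b"
    and i: "i \<in> S"
  shows "p (\<phi> i) = p i"
proof -
  have \<phi>S: "\<phi> a \<in> S" if "a \<in> S" for a using bij that by (auto simp: bij_betw_def)
  \<comment> \<open>The states at which the ratio agrees with its value at \<open>i\<close>.\<close>
  let ?A = "{a \<in> S. p (\<phi> a) * p i = p (\<phi> i) * p a}"
  have "?A = S"
  proof (rule ccontr)
    assume "?A \<noteq> S"
    then have "?A \<subset> S" by blast
    moreover have "?A \<noteq> {}" using i by auto
    ultimately obtain a b where ab: "a \<in> ?A" "b \<in> S - ?A" "Q a b > 0"
      using exit_edge[of ?A] by blast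
    have 1: "p a * Q a b = p b * Q b a" using detailed_balance ab by auto
    have 2: "p (\<phi> a) * Q a b = p (\<phi> b) * Q b a"
      using detailed_balance[of "\<phi> a" "\<phi> b"] Q \<phi>S ab by auto
    have "p a * Q a b > 0" using ab law_pos by auto
    then have "Q b a \<noteq> 0" using 1 by auto
    have "(p (\<phi> b) * p i) * Q b a = (p (\<phi> a) * p i) * Q a b" using 2 by (simp add: algebra_simps)
    also have "\<dots> = (p (\<phi> i) * p a) * Q a b" using ab by simp
    also have "\<dots> = (p (\<phi> i) * p b) * Q b a" using 1 by (simp add: algebra_simps)
    finally have "b \<in> ?A" using \<open>Q b a \<noteq> 0\<close> ab by simp
    then show False using ab by blast
  qed
  then have "(\<Sum>a\<in>S. p (\<phi> a) * p i) = (\<Sum>a\<in>S. p (\<phi> i) * p a)"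
    by (intro sum.cong) auto
  moreover have "(\<Sum>a\<in>S. p (\<phi> a)) = sum p S"
    using sum.reindex_bij_betw[OF bij] .
  ultimately show ?thesis
    using law_total by (simp flip: sum_distrib_left sum_distrib_right)
qed


section \<open>Boundary flow and its minimisers\<close>

definition flow :: "'a set \<Rightarrow> real" where
  "flow A = (\<Sum>i\<in>A. \<Sum>j\<in>S - A. p i * Q i j)"

lemma flow_alt:
  assumes "A \<subseteq> S"
  shows "flow A = (\<Sum>i\<in>S. \<Sum>j\<in>S. of_bool (i \<in> A \<and> j \<notin> A) * (p i * Q i j))"
proof -
  have "(\<Sum>j\<in>S - A. p i * Q i j) = (\<Sum>j\<in>S. of_bool (i \<in> A \<and> j \<notin> A) * (p i * Q i j))"
    if "i \<in> A" for i
    by (rule sum.mono_neutral_cong_left) (use finite_states that in auto)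
  then show ?thesis
    unfolding flow_def
    by (intro sum.mono_neutral_cong_left) (use finite_states assms in auto)
qed

lemma flow_complement:
  assumes "A \<subseteq> S"
  shows "flow (S - A) = flow A"
proof -
  have "flow (S - A) = (\<Sum>i\<in>S - A. \<Sum>j\<in>A. p j * Q j i)"
    unfolding flow_def using assms
    by (intro sum.cong) (auto intro: detailed_balance)
  also have "\<dots> = flow A" unfolding flow_def by (rule sum.swap)
  finally show ?thesis .
qed

text \<open>
  Pair by pair: if \<open>(i, j)\<close> leaves \<open>A \<union> B\<close> or \<open>A \<inter> B\<close> then it leaves \<open>A\<close> or \<open>B\<close>, and if it leaves
  both of the former then it leaves both of the latter.
\<close>

lemma flow_submodular:
  assumes "A \<subseteq> S" "B \<subseteq> S"
  shows "flow (A \<union> B) + flow (A \<inter> B) \<le> flow A + flow B"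
proof -
  have AB: "A \<union> B \<subseteq> S" "A \<inter> B \<subseteq> S" using assms by auto
  have "of_bool (i \<in> A \<union> B \<and> j \<notin> A \<union> B) * (p i * Q i j) +
        of_bool (i \<in> A \<inter> B \<and> j \<notin> A \<inter> B) * (p i * Q i j) \<le>
        of_bool (i \<in> A \<and> j \<notin> A) * (p i * Q i j) + of_bool (i \<in> B \<and> j \<notin> B) * (p i * Q i j)"
    if "i \<in> S" "j \<in> S" for i j
    \<comment> \<open>The diagonal rates are negative, but a pair \<open>(i, i)\<close> leaves no set.\<close>
  proof (cases "i = j")
    case False
    then have "p i * Q i j \<ge> 0" using that rate_nonneg law_nonneg by simp
    then show ?thesis by auto
  qed auto
  then show ?thesis
    unfolding flow_alt[OF assms(1)] flow_alt[OF assms(2)] flow_alt[OF AB(1)] flow_alt[OF AB(2)]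
    by (simp only: sum.distrib[symmetric]) (intro sum_mono)
qed

lemma flow_pos:
  assumes "A \<noteq> {}" "A \<subset> S"
  shows "flow A > 0"
proof -
  obtain a b where ab: "a \<in> A" "b \<in> S - A" "Q a b > 0"
    using assms by (rule exit_edge)
  have fin: "finite A" "finite (S - A)" using assms finite_states finite_subset by blast+
  have nn: "p i * Q i j \<ge> 0" if "i \<in> A" "j \<in> S - A" for i j
    using that assms rate_nonneg[of i j] law_nonneg[of i] by (intro mult_nonneg_nonneg) auto
  have "0 < p a * Q a b" using ab law_pos assms by auto
  then have "0 < (\<Sum>j\<in>S - A. p a * Q a j)"
    using ab nn fin by (intro sum_pos2[of _ b]) auto
  then show ?thesis
    unfolding flow_def using ab nn fin by (subst sum_pos2[of _ a]) (auto intro!: sum_nonneg)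
qed

lemma law_image:
  assumes "bij_betw \<phi> S S" "\<forall>a\<in>S. \<forall>b\<in>S. Q (\<phi> a) (\<phi> b) = Q a b" "A \<subseteq> S"
  shows "sum p (\<phi> ` A) = sum p A"
proof -
  have "inj_on \<phi> A" using assms inj_on_subset[of \<phi> S A] by (auto simp: bij_betw_def)
  then have "sum p (\<phi> ` A) = (\<Sum>a\<in>A. p (\<phi> a))" by (simp add: sum.reindex)
  also have "\<dots> = sum p A"
    using assms by (intro sum.cong) (auto simp: law_automorphism_invariant)
  finally show ?thesis .
qed

lemma flow_image:
  assumes "bij_betw \<phi> S S" "\<forall>a\<in>S. \<forall>b\<in>S. Q (\<phi> a) (\<phi> b) = Q a b" "A \<subseteq> S"
  shows "flow (\<phi> ` A) = flow A"
proof -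
  have inj: "inj_on \<phi> S" and im: "\<phi> ` S = S" using assms by (auto simp: bij_betw_def)
  have "S - \<phi> ` A = \<phi> ` (S - A)"
    using inj_on_image_set_diff[OF inj, of S A] assms im by auto
  moreover have "inj_on \<phi> A" "inj_on \<phi> (S - A)" using inj_on_subset[OF inj] assms by auto
  ultimately have "flow (\<phi> ` A) = (\<Sum>a\<in>A. \<Sum>b\<in>S - A. p (\<phi> a) * Q (\<phi> a) (\<phi> b))"
    by (simp add: flow_def sum.reindex)
  also have "\<dots> = flow A"
    unfolding flow_def using assms by (intro sum.cong) (auto simp: law_automorphism_invariant subset_iff)
  finally show ?thesis .
qed

text \<open>The sets over which the bottleneck ratio minimises.\<close>

definition small :: "'a set \<Rightarrow> bool" where
  "small A \<longleftrightarrow> A \<noteq> {} \<and> A \<subset> S \<and> sum p A \<le> 1 / 2"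

lemma finite_small: "finite {A. small A}"
  by (rule finite_subset[of _ "Pow S"]) (auto simp: small_def finite_states)

lemma law_pos_set:
  assumes "A \<noteq> {}" "A \<subseteq> S"
  shows "sum p A > 0"
  using assms finite_subset[OF assms(2) finite_states] by (intro sum_pos) (auto intro: law_pos)

text \<open>One of a singleton and its complement has mass at most \<open>1 / 2\<close>.\<close>

lemma ex_small: "\<exists>A. small A"
proof -
  obtain a where a: "a \<in> S" using card_states by fastforce
  have ne: "S \<noteq> {a}" using card_states by auto
  have "sum p S = sum p {a} + sum p (S - {a})"
    using a finite_states by (simp add: sum.remove)
  then have "sum p {a} \<le> 1 / 2 \<or> sum p (S - {a}) \<le> 1 / 2" using law_total by auto
  then show ?thesis
  proof
    assume "sum p {a} \<le> 1 / 2"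
    then have "small {a}" using a ne unfolding small_def by auto
    then show ?thesis ..
  next
    assume "sum p (S - {a}) \<le> 1 / 2"
    then have "small (S - {a})" using a ne unfolding small_def by auto
    then show ?thesis ..
  qed
qed

lemma bottleneck_ratio_eq_Min:
  "bottleneck_ratio S Q p = Min ((\<lambda>A. flow A / sum p A) ` {A. small A})"
proof -
  have "{bottleneck_ratio_of S Q p A | A. A \<noteq> {} \<and> A \<subset> S \<and> (\<Sum>i\<in>A. p i) \<le> 1 / 2}
     = (\<lambda>A. flow A / sum p A) ` {A. small A}"
    by (auto simp: bottleneck_ratio_of_def flow_def small_def)
  then show ?thesis
    unfolding bottleneck_ratio_def
    using finite_small ex_small by (subst cInf_eq_Min[symmetric]) auto
qed

lemma bottleneck_attained:
  obtains A where "small A" "flow A = bottleneck_ratio S Q p * sum p A"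
proof -
  have "bottleneck_ratio S Q p \<in> (\<lambda>A. flow A / sum p A) ` {A. small A}"
    unfolding bottleneck_ratio_eq_Min
    using finite_small ex_small by (intro Min_in) auto
  then obtain A where A: "small A" "bottleneck_ratio S Q p = flow A / sum p A" by auto
  moreover have "sum p A > 0" using A law_pos_set by (auto simp: small_def)
  ultimately show ?thesis using that by simp
qed

lemma bottleneck_pos: "bottleneck_ratio S Q p > 0"
proof -
  obtain A where A: "small A" "flow A = bottleneck_ratio S Q p * sum p A"
    by (rule bottleneck_attained)
  then have "flow A > 0" "sum p A > 0"
    using law_pos_set[of A] flow_pos[of A] by (auto simp: small_def)
  then show ?thesis using A(2) by (simp add: zero_less_mult_iff)
qed

lemma bottleneck_le_flow:
  assumes "A \<subset> S" "sum p A \<le> 1 / 2"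
  shows "bottleneck_ratio S Q p * sum p A \<le> flow A"
proof (cases "A = {}")
  case False
  then have "small A" using assms by (simp add: small_def)
  then have "bottleneck_ratio S Q p \<le> flow A / sum p A"
    unfolding bottleneck_ratio_eq_Min using finite_small by (intro Min_le) auto
  moreover have "sum p A > 0" using False assms law_pos_set by auto
  ultimately show ?thesis by (simp add: field_simps)
qed (simp add: flow_def)

text \<open>
  The intersection has mass at most \<open>1 / 2\<close> and so cannot have flow below \<open>\<Phi> * p (A \<inter> B)\<close>;
  submodularity then leaves at most
  \<open>\<Phi> * (p A + p B - p (A \<inter> B)) = \<Phi> * p (A \<union> B)\<close> for the flow of the union.
\<close>

lemma bottleneck_attained_union:
  assumes A: "A \<subset> S" "sum p A \<le> 1 / 2" "flow A = bottleneck_ratio S Q p * sum p A"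
    and B: "B \<subset> S" "sum p B \<le> 1 / 2" "flow B = bottleneck_ratio S Q p * sum p B"
    and AB: "A \<union> B \<subset> S" "sum p (A \<union> B) \<le> 1 / 2"
  shows "flow (A \<union> B) = bottleneck_ratio S Q p * sum p (A \<union> B)"
proof (rule antisym)
  let ?\<Phi> = "bottleneck_ratio S Q p"
  have fin: "finite A" "finite B" using A B finite_states finite_subset by blast+
  have law: "sum p (A \<union> B) = sum p A + sum p B - sum p (A \<inter> B)"
    using sum.union_inter[OF fin, of p] by linarith
  have "sum p (A \<inter> B) \<le> sum p A"
    using A fin by (intro sum_mono2) (auto intro: law_nonneg)
  then have "?\<Phi> * sum p (A \<inter> B) \<le> flow (A \<inter> B)"
    using A by (intro bottleneck_le_flow) auto
  then have "flow (A \<union> B) \<le> ?\<Phi> * (sum p A + sum p B - sum p (A \<inter> B))"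
    using flow_submodular[OF psubset_imp_subset[OF A(1)] psubset_imp_subset[OF B(1)]] A B
    by (simp add: algebra_simps)
  then show "flow (A \<union> B) \<le> ?\<Phi> * sum p (A \<union> B)" using law by simp
qed (rule bottleneck_le_flow[OF AB])

text \<open>
  A set that attains the bottleneck ratio may have arbitrarily small mass, and its indicator then has
  small variance. Transitivity allows such a set to be enlarged by one of its own translates at no
  cost in the ratio, until the mass reaches \<open>1 / 4\<close>.
\<close>

lemma large_bottleneck_set:
  assumes "transitive_chain S Q"
  obtains B where "B \<subseteq> S" "1 / 4 \<le> sum p B" "sum p B \<le> 1 / 2"
    "flow B = bottleneck_ratio S Q p * sum p B"
proof -
  let ?\<Phi> = "bottleneck_ratio S Q p"
  let ?\<M> = "{A. small A \<and> flow A = ?\<Phi> * sum p A}"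
  have "finite ?\<M>" using finite_small by (rule rev_finite_subset) auto
  moreover have "?\<M> \<noteq> {}" using bottleneck_attained by blast
  ultimately obtain B where B: "B \<in> ?\<M>" and max: "\<And>A. A \<in> ?\<M> \<Longrightarrow> B \<subseteq> A \<Longrightarrow> A = B"
    using finite_has_maximal[of ?\<M>] by blast
  have BS: "B \<subset> S" "B \<noteq> {}" "sum p B \<le> 1 / 2" "flow B = ?\<Phi> * sum p B"
    using B by (auto simp: small_def)
  have "1 / 4 \<le> sum p B"
  proof (rule ccontr)
    assume less: "\<not> 1 / 4 \<le> sum p B"
    \<comment> \<open>A symmetry that moves a point of \<open>B\<close> out of \<open>B\<close>, so that \<open>B\<close> does not contain its translate.\<close>
    obtain a b where ab: "a \<in> B" "b \<in> S - B" using BS by blast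
    then obtain \<phi> where \<phi>: "bij_betw \<phi> S S" "\<phi> a = b" "\<forall>a\<in>S. \<forall>b\<in>S. Q (\<phi> a) (\<phi> b) = Q a b"
      using assms BS unfolding transitive_chain_def by blast
    let ?C = "\<phi> ` B"
    have C: "sum p ?C = sum p B" "flow ?C = flow B"
      using law_image flow_image \<phi> BS by auto
    have CS: "?C \<subseteq> S" using bij_betw_imp_surj_on[OF \<phi>(1)] BS by blast
    have fin: "finite B" "finite ?C" using BS finite_states finite_subset by blast+
    have proper: "A \<subset> S" if "A \<subseteq> S" "sum p A \<le> 1 / 2" for A
      using that law_total by auto
    have "sum p (B \<inter> ?C) \<ge> 0" using BS by (intro sum_nonneg law_nonneg) auto
    then have u: "sum p (B \<union> ?C) \<le> 1 / 2"
      using sum.union_inter[OF fin, of p] C less by linarith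
    have "B \<union> ?C \<subset> S" using proper u BS CS by auto
    then have "B \<union> ?C \<in> ?\<M>"
      using u BS C CS proper[of ?C] bottleneck_attained_union[of B ?C] by (auto simp: small_def)
    then have "B \<union> ?C = B" using max by blast
    then show False using ab \<phi> by blast
  qed
  then show ?thesis using that BS by blast
qed


section \<open>The transition matrix\<close>

lemma matrix_power_bound:
  assumes "i \<in> S"
  shows "\<bar>matrix_power S Q k i j\<bar> \<le> (\<Sum>i\<in>S. \<Sum>j\<in>S. \<bar>Q i j\<bar>) ^ k"
  using assms
proof (induction k arbitrary: i)
  case (Suc k)
  let ?K = "\<Sum>i\<in>S. \<Sum>j\<in>S. \<bar>Q i j\<bar>"
  have "\<bar>matrix_power S Q (Suc k) i j\<bar> \<le> (\<Sum>l\<in>S. \<bar>Q i l\<bar> * \<bar>matrix_power S Q k l j\<bar>)"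
    by (simp flip: abs_mult)
  also have "\<dots> \<le> (\<Sum>l\<in>S. \<bar>Q i l\<bar> * ?K ^ k)"
    using Suc by (intro sum_mono mult_left_mono) auto
  also have "\<dots> = (\<Sum>l\<in>S. \<bar>Q i l\<bar>) * ?K ^ k" by (simp add: sum_distrib_right)
  also have "\<dots> \<le> ?K * ?K ^ k"
    using Suc.prems finite_states
    by (intro mult_right_mono member_le_sum[of i S "\<lambda>i. \<Sum>l\<in>S. \<bar>Q i l\<bar>"])
       (auto intro!: sum_nonneg zero_le_power)
  finally show ?case by simp
qed simp

lemma transition_summable:
  assumes "i \<in> S"
  shows "summable (\<lambda>k. t ^ k / fact k * matrix_power S Q k i j)"
proof (rule summable_comparison_test')
  let ?K = "\<Sum>i\<in>S. \<Sum>j\<in>S. \<bar>Q i j\<bar>"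
  show "summable (\<lambda>k. inverse (fact k) * (\<bar>t\<bar> * ?K) ^ k)" by (rule summable_exp)
  show "norm (t ^ k / fact k * matrix_power S Q k i j) \<le> inverse (fact k) * (\<bar>t\<bar> * ?K) ^ k"
    if "k \<ge> 0" for k
    using matrix_power_bound[OF assms, of k j]
    by (simp add: abs_mult power_abs power_mult_distrib divide_inverse mult_left_mono mult.assoc
        mult.left_commute)
qed

lemma transition_0: "transition S Q 0 i j = of_bool (i = j)"
  using powser_zero[of "\<lambda>k. matrix_power S Q k i j / fact k"]
  by (simp add: transition_def mult.commute)

lemma transition_deriv_0:
  assumes "i \<in> S" "j \<in> S"
  shows "((\<lambda>t. transition S Q t i j) has_real_derivative Q i j) (at 0)"
proof -
  let ?c = "\<lambda>k. matrix_power S Q k i j / fact k"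
  have "summable (\<lambda>k. ?c k * y ^ k)" for y
    using transition_summable[OF assms(1), of y j] by (simp add: mult.commute)
  then have "((\<lambda>t. \<Sum>k. ?c k * t ^ k) has_real_derivative (\<Sum>k. diffs ?c k * 0 ^ k)) (at 0)"
    by (rule termdiffs_strong_converges_everywhere)
  moreover have "(\<Sum>k. diffs ?c k * 0 ^ k) = diffs ?c 0" by (rule powser_zero)
  moreover have "diffs ?c 0 = (\<Sum>l\<in>S. if l = j then Q i l else 0)"
    unfolding diffs_def by (simp add: if_distrib cong: if_cong)
  ultimately show ?thesis
    using assms finite_states by (simp add: transition_def mult.commute)
qed

text \<open>
  Stationarity annihilates every term of the exponential series of positive degree.
\<close>

lemma stationary_transition:
  assumes "j \<in> S"
  shows "(\<Sum>i\<in>S. p i * transition S Q t i j) = p j"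
proof -
  have power: "(\<Sum>i\<in>S. p i * matrix_power S Q k i j) = (if k = 0 then p j else 0)" for k
  proof (cases k)
    case 0
    then show ?thesis using assms finite_states by (simp add: if_distrib cong: if_cong)
  next
    case (Suc m)
    have "(\<Sum>i\<in>S. p i * matrix_power S Q k i j)
        = (\<Sum>i\<in>S. \<Sum>l\<in>S. p i * Q i l * matrix_power S Q m l j)"
      by (simp add: Suc sum_distrib_left mult.assoc)
    also have "\<dots> = (\<Sum>l\<in>S. (\<Sum>i\<in>S. p i * Q i l) * matrix_power S Q m l j)"
      by (subst sum.swap) (simp add: sum_distrib_right)
    also have "\<dots> = 0" using stationary by (simp add: stationary_def)
    finally show ?thesis using Suc by simp
  qed
  have sm: "summable (\<lambda>k. p i * (t ^ k / fact k * matrix_power S Q k i j))" if "i \<in> S" for i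
    using transition_summable[OF that] by (rule summable_mult)
  have "(\<Sum>i\<in>S. p i * transition S Q t i j)
      = (\<Sum>i\<in>S. \<Sum>k. p i * (t ^ k / fact k * matrix_power S Q k i j))"
    unfolding transition_def
    by (intro sum.cong suminf_mult[symmetric] transition_summable) auto
  also have "\<dots> = (\<Sum>k. \<Sum>i\<in>S. p i * (t ^ k / fact k * matrix_power S Q k i j))"
    using sm by (rule suminf_sum[symmetric])
  also have "\<dots> = (\<Sum>k. t ^ k / fact k * (\<Sum>i\<in>S. p i * matrix_power S Q k i j))"
    by (simp add: sum_distrib_left mult.left_commute)
  also have "\<dots> = (\<Sum>k. (if k = 0 then p j else 0) * t ^ k)"
    by (intro arg_cong[where f = suminf] ext) (simp add: power)
  also have "\<dots> = p j"
    by (subst suminf_finite[of "{0}"]) auto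
  finally show ?thesis .
qed

end


section \<open>The probability that an observable changes\<close>

locale stationary_process = reversible_chain S Q p
  for S :: "'a set" and Q p +
  fixes M :: "'w measure" and X :: "real \<Rightarrow> 'w \<Rightarrow> 'a"
  assumes markov: "markov_chain M S Q p X"
begin

sublocale prob_space M
  using markov by (simp add: markov_chain_def)

lemma measurable_X: "t \<ge> 0 \<Longrightarrow> X t \<in> measurable M (count_space S)"
  using markov by (simp add: markov_chain_def)

lemma X_in: "t \<ge> 0 \<Longrightarrow> w \<in> space M \<Longrightarrow> X t w \<in> S"
  using measurable_space[OF measurable_X] by simp

lemma fibre_measurable:
  assumes "t \<ge> 0"
  shows "{w \<in> space M. X t w = i} \<in> events"
proof -
  have "X t -` ({i} \<inter> S) \<inter> space M \<in> events"
    using measurable_X[OF assms] by (rule measurable_sets) simp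
  moreover have "X t -` ({i} \<inter> S) \<inter> space M = {w \<in> space M. X t w = i}"
    using X_in[OF assms] by auto
  ultimately show ?thesis by simp
qed

lemma joint_measurable:
  assumes "s \<ge> 0" "t \<ge> 0"
  shows "{w \<in> space M. X s w = i \<and> X t w = j} \<in> events"
  using sets.Int[OF fibre_measurable[OF assms(1), of i] fibre_measurable[OF assms(2), of j]]
  by (rule back_subst[of "\<lambda>A. A \<in> events"]) auto

lemma fdd:
  assumes "t 0 = 0" "\<And>k. k < m \<Longrightarrow> t k \<le> t (Suc k)" "\<And>k. k \<le> m \<Longrightarrow> x k \<in> S"
  shows "prob {w \<in> space M. \<forall>k\<le>m. X (t k) w = x k} =
          p (x 0) * (\<Prod>k<m. transition S Q (t (Suc k) - t k) (x k) (x (Suc k)))"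
  using markov assms unfolding markov_chain_def by blast

lemma joint_law_3:
  assumes "s \<ge> 0" "t \<ge> 0" "i \<in> S" "l \<in> S" "j \<in> S"
  shows "prob {w \<in> space M. X 0 w = i \<and> X s w = l \<and> X (s + t) w = j} =
          p i * transition S Q s i l * transition S Q t l j"
proof -
  let ?t = "\<lambda>k::nat. if k = 0 then 0 else if k = 1 then s else s + t"
  let ?x = "\<lambda>k::nat. if k = 0 then i else if k = 1 then l else j"
  have "prob {w \<in> space M. \<forall>k\<le>2. X (?t k) w = ?x k} =
      p (?x 0) * (\<Prod>k<2. transition S Q (?t (Suc k) - ?t k) (?x k) (?x (Suc k)))"
    by (rule fdd) (use assms in auto)
  moreover have "(\<forall>k\<le>2. X (?t k) w = ?x k) \<longleftrightarrow> X 0 w = i \<and> X s w = l \<and> X (s + t) w = j" for w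
    by (auto simp: numeral_2_eq_2 le_Suc_eq)
  ultimately show ?thesis by (simp add: numeral_2_eq_2)
qed

text \<open>
  The finite-dimensional distributions always include time \<open>0\<close>; summing over the initial state and
  using stationarity gives the law of a pair at later times. It depends only on the time difference.
\<close>

lemma joint_law:
  assumes "s \<ge> 0" "t \<ge> 0" "l \<in> S" "j \<in> S"
  shows "prob {w \<in> space M. X s w = l \<and> X (s + t) w = j} = p l * transition S Q t l j"
proof -
  let ?E = "\<lambda>i. {w \<in> space M. X 0 w = i \<and> X s w = l \<and> X (s + t) w = j}"
  have E: "?E i \<in> events" for i
  proof -
    have "{w \<in> space M. X 0 w = i} \<inter> {w \<in> space M. X s w = l \<and> X (s + t) w = j} \<in> events"
      using assms by (intro sets.Int fibre_measurable joint_measurable) auto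
    also have "{w \<in> space M. X 0 w = i} \<inter> {w \<in> space M. X s w = l \<and> X (s + t) w = j} = ?E i"
      by auto
    finally show ?thesis .
  qed
  have "{w \<in> space M. X s w = l \<and> X (s + t) w = j} = (\<Union>i\<in>S. ?E i)"
    using X_in[of 0] by auto
  then have "prob {w \<in> space M. X s w = l \<and> X (s + t) w = j} = (\<Sum>i\<in>S. prob (?E i))"
    using finite_states E
    by (simp only:) (rule finite_measure_finite_Union, auto simp: disjoint_family_on_def)
  also have "\<dots> = (\<Sum>i\<in>S. p i * transition S Q s i l) * transition S Q t l j"
    using assms by (simp add: joint_law_3 sum_distrib_right)
  also have "\<dots> = p l * transition S Q t l j"
    using assms by (simp add: stationary_transition)
  finally show ?thesis .
qed

lemma change_event_eq:
  assumes "s \<ge> 0" "t \<ge> 0"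
  shows "{w \<in> space M. f (X s w) \<noteq> f (X t w)} =
    (\<Union>x\<in>{(l, j) \<in> S \<times> S. f l \<noteq> f j}. {w \<in> space M. X s w = fst x \<and> X t w = snd x})"
  using X_in assms by auto

lemma finite_pairs: "finite {(l, j) \<in> S \<times> S. f l \<noteq> f j}"
  using finite_states by (auto intro: rev_finite_subset[of "S \<times> S"])

lemma change_event_measurable:
  assumes "s \<ge> 0" "t \<ge> 0"
  shows "{w \<in> space M. f (X s w) \<noteq> f (X t w)} \<in> events"
  unfolding change_event_eq[OF assms]
  using finite_pairs joint_measurable[OF assms] by (intro sets.finite_UN) auto

lemma change_prob:
  assumes "s \<ge> 0" "t \<ge> 0"
  shows "prob {w \<in> space M. f (X s w) \<noteq> f (X (s + t) w)} =
    (\<Sum>(l, j)\<in>{(l, j) \<in> S \<times> S. f l \<noteq> f j}. p l * transition S Q t l j)"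
proof -
  have "prob {w \<in> space M. f (X s w) \<noteq> f (X (s + t) w)} =
    (\<Sum>x\<in>{(l, j) \<in> S \<times> S. f l \<noteq> f j}. prob {w \<in> space M. X s w = fst x \<and> X (s + t) w = snd x})"
    using assms finite_pairs joint_measurable
    by (subst change_event_eq, simp, simp, intro finite_measure_finite_Union)
       (auto simp: disjoint_family_on_def)
  also have "\<dots> = (\<Sum>(l, j)\<in>{(l, j) \<in> S \<times> S. f l \<noteq> f j}. p l * transition S Q t l j)"
    using assms by (intro sum.cong) (auto simp: joint_law)
  finally show ?thesis .
qed

text \<open>
  If \<open>f\<close> differs at the ends of an interval, it differs at the ends of one of its \<open>k\<close> equal parts, and
  by stationarity each part contributes the same probability.
\<close>

lemma change_prob_multiple:
  assumes "t \<ge> 0"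
  shows "prob {w \<in> space M. f (X 0 w) \<noteq> f (X (real k * t) w)} \<le>
    real k * prob {w \<in> space M. f (X 0 w) \<noteq> f (X t w)}"
proof (induction k)
  case (Suc k)
  let ?D = "\<lambda>s t. {w \<in> space M. f (X s w) \<noteq> f (X t w)}"
  have kt: "real k * t \<ge> 0" "real (Suc k) * t = real k * t + t" "real (Suc k) * t \<ge> 0"
    using assms by (auto simp: algebra_simps)
  have "prob (?D 0 (real (Suc k) * t)) \<le>
      prob (?D 0 (real k * t) \<union> ?D (real k * t) (real (Suc k) * t))"
    using kt by (intro finite_measure_mono sets.Un change_event_measurable) auto
  also have "\<dots> \<le> prob (?D 0 (real k * t)) + prob (?D (real k * t) (real (Suc k) * t))"
    using kt by (intro measure_Un_le change_event_measurable) auto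
  also have "prob (?D (real k * t) (real (Suc k) * t)) = prob (?D 0 t)"
    using change_prob[of "real k * t" t f] change_prob[of 0 t f] kt assms by simp
  finally show ?case using Suc.IH by (simp add: algebra_simps)
qed simp

text \<open>
  Let \<open>D t\<close> be the probability on the left. Subadditivity gives \<open>D t / t \<le> D (t / k) / (t / k)\<close> for all
  \<open>k\<close>, and as \<open>k\<close> grows the right-hand side tends to the derivative of \<open>D\<close> at \<open>0\<close>, which is read off from
  the transition matrix.
\<close>

lemma change_prob_le_deriv:
  assumes "t \<ge> 0"
  shows "prob {w \<in> space M. f (X 0 w) \<noteq> f (X t w)} \<le>
    t * (\<Sum>(l, j)\<in>{(l, j) \<in> S \<times> S. f l \<noteq> f j}. p l * Q l j)"
proof (cases "t = 0")
  case False
  then have t: "t > 0" using assms by simp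
  let ?P = "{(l, j) \<in> S \<times> S. f l \<noteq> f j}"
  \<comment> \<open>Unlike the probability, this expression makes sense for negative times, so that it has a
    two-sided derivative at \<open>0\<close>.\<close>
  define F where "F u = (\<Sum>(l, j)\<in>?P. p l * transition S Q u l j)" for u
  have F0: "F 0 = 0" by (auto simp: F_def transition_0 intro!: sum.neutral)
  have "(F has_real_derivative (\<Sum>(l, j)\<in>?P. p l * Q l j)) (at 0)"
    unfolding F_def split_beta
    by (intro DERIV_sum DERIV_cmult transition_deriv_0) auto
  then have "((\<lambda>h. F h / h) \<longlongrightarrow> (\<Sum>(l, j)\<in>?P. p l * Q l j)) (at 0)"
    by (simp add: DERIV_def F0)
  moreover have "filterlim (\<lambda>k. t / real (Suc k)) (at 0) sequentially"
    unfolding filterlim_at using t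
    by (auto intro!: real_tendsto_divide_at_top[OF tendsto_const]
      filterlim_compose[OF filterlim_real_sequentially filterlim_Suc] simp del: of_nat_Suc)
  ultimately have lim: "(\<lambda>k. F (t / real (Suc k)) / (t / real (Suc k))) \<longlonglongrightarrow> (\<Sum>(l, j)\<in>?P. p l * Q l j)"
    by (rule filterlim_compose)
  have F: "prob {w \<in> space M. f (X 0 w) \<noteq> f (X u w)} = F u" if "u \<ge> 0" for u
    using change_prob[of 0 u f] that by (simp add: F_def)
  have "F t / t \<le> F (t / real (Suc k)) / (t / real (Suc k))" for k
  proof -
    have "F t \<le> real (Suc k) * F (t / real (Suc k))"
      using change_prob_multiple[of "t / real (Suc k)" f "Suc k"] t by (simp add: F)
    then show ?thesis using t by (simp add: field_simps)
  qed
  then have "F t / t \<le> (\<Sum>(l, j)\<in>?P. p l * Q l j)"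
    by (intro LIMSEQ_le_const[OF lim]) auto
  then show ?thesis using t F by (simp add: field_simps)
qed simp

text \<open>
  The indicator changes when the process leaves \<open>B\<close> or enters it; in equilibrium the two flows are
  equal, hence the factor \<open>2\<close>.
\<close>

lemma indicator_change_prob:
  assumes "t \<ge> 0" "B \<subseteq> S"
  shows "prob {w \<in> space M. (indicator B (X 0 w) :: real) \<noteq> indicator B (X t w)} \<le> 2 * t * flow B"
proof -
  have "{(l, j) \<in> S \<times> S. (indicator B l :: real) \<noteq> indicator B j} = B \<times> (S - B) \<union> (S - B) \<times> B"
    using assms by (auto simp: indicator_def split: if_splits)
  moreover have "finite B" using assms finite_states finite_subset by blast
  ultimately have "(\<Sum>(l, j)\<in>{(l, j) \<in> S \<times> S. (indicator B l :: real) \<noteq> indicator B j}. p l * Q l j)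
      = flow B + (\<Sum>l\<in>S - B. \<Sum>j\<in>B. p l * Q l j)"
    using finite_states by (simp add: flow_def sum.cartesian_product) (subst sum.union_disjoint, auto)
  also have "(\<Sum>l\<in>S - B. \<Sum>j\<in>B. p l * Q l j) = flow (S - B)"
    using assms by (simp add: flow_def double_diff)
  finally show ?thesis
    using change_prob_le_deriv[OF assms(1), of "indicator B :: 'a \<Rightarrow> real"] flow_complement[OF assms(2)]
    by (simp add: algebra_simps)
qed

end


section \<open>Noise stable sequences of large bottleneck sets\<close>

lemma variance_on_indicator:
  assumes "finite S" "sum p S = 1" "B \<subseteq> S"
  shows "variance_on S p (indicator B) = sum p B * (1 - sum p B)"
proof -
  have "{i \<in> S. i \<in> B} = B" using assms by auto
  then have m: "mean_on S p (indicator B) = sum p B"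
    using assms by (simp add: mean_on_def)
  have "variance_on S p (indicator B)
      = (\<Sum>i\<in>S. (1 - 2 * sum p B) * (p i * indicator B i) + (sum p B)\<^sup>2 * p i)"
    unfolding variance_on_def m
    by (auto simp: mean_on_def indicator_def power2_eq_square algebra_simps intro!: sum.cong)
  also have "\<dots> = (1 - 2 * sum p B) * mean_on S p (indicator B) + (sum p B)\<^sup>2"
    using assms by (simp add: sum.distrib mean_on_def flip: sum_distrib_left)
  finally show ?thesis by (simp add: m power2_eq_square algebra_simps)
qed

theorem proposition4p1:
  fixes S :: "nat \<Rightarrow> 'a set"
    and Q :: "nat \<Rightarrow> 'a \<Rightarrow> 'a \<Rightarrow> real"
    and p :: "nat \<Rightarrow> 'a \<Rightarrow> real"
    and M :: "nat \<Rightarrow> 'w measure"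
    and X :: "nat \<Rightarrow> real \<Rightarrow> 'w \<Rightarrow> 'a"
  assumes "\<And>n. n \<ge> 1 \<Longrightarrow> finite (S n)"
    and "\<And>n. n \<ge> 1 \<Longrightarrow> card (S n) \<ge> 2"
    and "\<And>n. n \<ge> 1 \<Longrightarrow> stationary (S n) (Q n) (p n)"
    and "\<And>n. n \<ge> 1 \<Longrightarrow> markov_chain (M n) (S n) (Q n) (p n) (X n)"
    and "\<And>n. n \<ge> 1 \<Longrightarrow> transitive_chain (S n) (Q n)"
    and "\<And>n. n \<ge> 1 \<Longrightarrow> reversible (S n) (Q n) (p n)"
    and "\<And>n. n \<ge> 1 \<Longrightarrow> irreducible_chain (S n) (Q n)"
    and "comparable (\<lambda>n. spectral_gap (S n) (Q n)) (\<lambda>n. bottleneck_ratio (S n) (Q n) (p n))"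
  shows "\<exists>f :: nat \<Rightarrow> 'a \<Rightarrow> real.
           (\<forall>n\<ge>1. f n \<in> S n \<rightarrow> {0, 1}) \<and> nondegenerate S p f \<and> noise_stable M S Q X f"
proof -
  have proc: "stationary_process (S n) (Q n) (p n) (M n) (X n)" if "n \<ge> 1" for n
    using assms(1-7)[OF that]
    by unfold_locales (auto simp: markov_chain_def)
  then have chain: "reversible_chain (S n) (Q n) (p n)" if "n \<ge> 1" for n
    using that stationary_process.axioms(1) by blast
  have "\<exists>B. B \<subseteq> S n \<and> 1 / 4 \<le> sum (p n) B \<and> sum (p n) B \<le> 1 / 2 \<and>
      reversible_chain.flow (S n) (Q n) (p n) B = bottleneck_ratio (S n) (Q n) (p n) * sum (p n) B"
    if "n \<ge> 1" for n
    using reversible_chain.large_bottleneck_set[OF chain[OF that] assms(5)[OF that]] by metis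
  then obtain B where B: "\<And>n. n \<ge> 1 \<Longrightarrow> B n \<subseteq> S n" "\<And>n. n \<ge> 1 \<Longrightarrow> 1 / 4 \<le> sum (p n) (B n)"
    "\<And>n. n \<ge> 1 \<Longrightarrow> sum (p n) (B n) \<le> 1 / 2"
    "\<And>n. n \<ge> 1 \<Longrightarrow> reversible_chain.flow (S n) (Q n) (p n) (B n) =
        bottleneck_ratio (S n) (Q n) (p n) * sum (p n) (B n)"
    by metis
  obtain c where c: "c > 0"
    and gap: "\<And>n. n \<ge> 1 \<Longrightarrow> c * bottleneck_ratio (S n) (Q n) (p n) \<le> spectral_gap (S n) (Q n)"
    using assms(8) unfolding comparable_def by blast
  define f :: "nat \<Rightarrow> 'a \<Rightarrow> real" where "f n = indicator (B n)" for n
  define D where "D n \<alpha> = measure (M n)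
      {w \<in> space (M n). f n (X n 0 w) \<noteq> f n (X n (\<alpha> * relaxation_time (S n) (Q n)) w)}" for n \<alpha>
  have "f n \<in> S n \<rightarrow> {0, 1}" for n by (auto simp: f_def indicator_def)
  moreover have "nondegenerate S p f"
  proof -
    have "1 / 8 \<le> variance_on (S n) (p n) (f n)" if "n \<ge> 1" for n
    proof -
      have "(1 / 4) * (1 / 2) \<le> sum (p n) (B n) * (1 - sum (p n) (B n))"
        using B[OF that] by (intro mult_mono) auto
      then show ?thesis
        using variance_on_indicator[of "S n" "p n" "B n"] assms(1)[OF that] B(1)[OF that]
          reversible_chain.law_total[OF chain[OF that]] by (simp add: f_def)
    qed
    then have "\<forall>\<^sub>F n in sequentially. ereal (1 / 8) \<le> ereal (variance_on (S n) (p n) (f n))"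
      unfolding eventually_sequentially by auto
    then have "ereal (1 / 8) \<le> liminf (\<lambda>n. ereal (variance_on (S n) (p n) (f n)))"
      by (rule Liminf_bounded)
    moreover have "(0 :: ereal) < ereal (1 / 8)" by simp
    ultimately show ?thesis unfolding nondegenerate_def by (rule less_le_trans[rotated])
  qed
  moreover have "noise_stable M S Q X f"
  proof -
    have D: "D n \<alpha> \<le> \<alpha> / c" if n: "n \<ge> 1" and "\<alpha> > 0" for n \<alpha>
    proof -
      let ?\<Phi> = "bottleneck_ratio (S n) (Q n) (p n)" and ?\<gamma> = "spectral_gap (S n) (Q n)"
      have \<Phi>: "?\<Phi> > 0" using reversible_chain.bottleneck_pos[OF chain[OF n]] .
      have "0 < c * ?\<Phi>" using c \<Phi> by simp
      also note gap[OF n]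
      finally have \<gamma>: "?\<gamma> > 0" .
      have "D n \<alpha> \<le> 2 * (\<alpha> * (1 / ?\<gamma>)) * (?\<Phi> * sum (p n) (B n))"
        unfolding D_def f_def relaxation_time_def B(4)[OF n, symmetric]
        using \<gamma> \<open>\<alpha> > 0\<close> B(1)[OF n]
        by (intro stationary_process.indicator_change_prob[OF proc[OF n]]) auto
      \<comment> \<open>The factor \<open>2\<close> for leaving and entering cancels against the mass bound \<open>1 / 2\<close>.\<close>
      also have "\<dots> = \<alpha> / ?\<gamma> * ?\<Phi> * (2 * sum (p n) (B n))" by simp
      also have "\<dots> \<le> \<alpha> / ?\<gamma> * ?\<Phi> * 1"
        using B(3)[OF n] \<Phi> \<gamma> \<open>\<alpha> > 0\<close> by (intro mult_left_mono) auto
      also have "\<dots> \<le> \<alpha> / c"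
        using gap[OF n] c \<gamma> \<open>\<alpha> > 0\<close> by (simp add: field_simps)
      finally show ?thesis .
    qed
    have "0 \<le> (SUP n\<in>{1..}. D n \<alpha>)" "(SUP n\<in>{1..}. D n \<alpha>) \<le> \<alpha> / c" if "\<alpha> > 0" for \<alpha>
    proof -
      have "bdd_above ((\<lambda>n. D n \<alpha>) ` {1..})"
        using D that by (intro bdd_aboveI[of _ "\<alpha> / c"]) auto
      then show "0 \<le> (SUP n\<in>{1..}. D n \<alpha>)"
        by (intro cSUP_upper2[of _ _ 1]) (auto simp: D_def)
      show "(SUP n\<in>{1..}. D n \<alpha>) \<le> \<alpha> / c"
        using D that by (intro cSUP_least) auto
    qed
    then have ev: "\<forall>\<^sub>F \<alpha> in at_right 0. 0 \<le> (SUP n\<in>{1..}. D n \<alpha>)"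
      "\<forall>\<^sub>F \<alpha> in at_right 0. (SUP n\<in>{1..}. D n \<alpha>) \<le> \<alpha> / c"
      by (auto simp: eventually_at_filter)
    have lim: "((\<lambda>\<alpha>. \<alpha> / c) \<longlongrightarrow> 0) (at_right 0)"
      using c by (auto intro!: tendsto_eq_intros)
    have "((\<lambda>\<alpha>. SUP n\<in>{1..}. D n \<alpha>) \<longlongrightarrow> 0) (at_right 0)"
      by (rule tendsto_sandwich[OF ev tendsto_const lim])
    then show ?thesis unfolding noise_stable_def D_def .
  qed
  ultimately show ?thesis by blast
qed

end
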